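(* Let $G$ be a finite group, and let $X$ be an effective semitransitive distributive binary $G$-space. Then $|X|=p^n$, where $p$ is a prime number and $n$ is a natural number.
   Context: A binary action of a topological group $G$ (identity $e$) on a topological space $X$ is a continuous map $\alpha: G\times X^2\to X$, written $\alpha(g,x,y)=g(x,y)$, such that $gh(x,y)=g(x,h(x,y))$ and $e(x,y)=y$ for all $g,h\in G$, $x,y\in X$; $X$ with such an action is a binary $G$-space. It is effective if the only $g\in G$ with $g(x,y)=y$ for all $x,y\in X$ is $g=e$. It is distributive if $g(x,h(y,z))=h(g(x,y),g(x,z))$ for all $g,h\in G$, $x,y,z\in X$. Write $G(x,y)=\{g(x,y): g\in G\}$. The binary $G$-space is semitransitive if (1) $G(x,x)=\{x\}$ for every $x\in X$, and (2) $G(x,y)=X\setminus\{x\}$ for all distinct $x,y\in X$. *)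

theory Defs
  imports "HOL-Analysis.Analysis" "HOL-Algebra.Group"
begin

text \<open>The topology \<open>T\<close> is arbitrary: no separation axiom is required of a topological group,
  and a finite group is not assumed to be discrete.\<close>

locale topological_group = group G
  for G :: "('g, 'm) monoid_scheme" (structure) and T :: "'g topology" +
  assumes topspace_group: "topspace T = carrier G"
    and continuous_map_mult: "continuous_map (prod_topology T T) T (\<lambda>(g, h). g \<otimes> h)"
    and continuous_map_inv: "continuous_map T T (\<lambda>g. inv g)"

text \<open>A binary action is written in curried form: \<open>act g x y\<close> is $g(x,y)$. Only its values on
  \<open>carrier G\<close> and \<open>topspace X\<close> matter; that it maps into \<open>topspace X\<close> there is part of
  the continuity assumption.\<close>

locale binary_G_space = topological_group G T
  for G :: "('g, 'm) monoid_scheme" (structure) and T :: "'g topology" +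
  fixes X :: "'x topology"
    and act :: "'g \<Rightarrow> 'x \<Rightarrow> 'x \<Rightarrow> 'x"
  assumes continuous_map_act:
      "continuous_map (prod_topology T (prod_topology X X)) X (\<lambda>(g, x, y). act g x y)"
    and act_mult: "\<lbrakk>g \<in> carrier G; h \<in> carrier G; x \<in> topspace X; y \<in> topspace X\<rbrakk>
      \<Longrightarrow> act (g \<otimes> h) x y = act g x (act h x y)"
    and act_one: "\<lbrakk>x \<in> topspace X; y \<in> topspace X\<rbrakk> \<Longrightarrow> act \<one> x y = y"
begin

definition orbit :: "'x \<Rightarrow> 'x \<Rightarrow> 'x set"
  where "orbit x y = {act g x y | g. g \<in> carrier G}"

definition effective :: bool
  where "effective \<longleftrightarrow>
    (\<forall>g\<in>carrier G. (\<forall>x\<in>topspace X. \<forall>y\<in>topspace X. act g x y = y) \<longrightarrow> g = \<one>)"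

definition distributive :: bool
  where "distributive \<longleftrightarrow>
    (\<forall>g\<in>carrier G. \<forall>h\<in>carrier G. \<forall>x\<in>topspace X. \<forall>y\<in>topspace X. \<forall>z\<in>topspace X.
      act g x (act h y z) = act h (act g x y) (act g x z))"

definition semitransitive :: bool
  where "semitransitive \<longleftrightarrow>
    (\<forall>x\<in>topspace X. orbit x x = {x}) \<and>
    (\<forall>x\<in>topspace X. \<forall>y\<in>topspace X. x \<noteq> y \<longrightarrow> orbit x y = topspace X - {x})"

end

end

theory Submission
  imports Defs "HOL-Algebra.Sylow" "HOL-Algebra.Multiplicative_Group"
    "HOL-Combinatorics.Permutations"
begin

text \<open>
  Distributivity says that every map \<open>y \<mapsto> g(x,y)\<close> is an automorphism of the family of binary
  operations \<open>(x,y) \<mapsto> h(x,y)\<close>. By semitransitivity these maps fix \<open>x\<close> and move any point other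
  than \<open>x\<close> to any other such point, so the automorphism group \<open>H\<close> is doubly transitive as soon
  as \<open>X\<close> has three points; one and two are prime powers anyway. An automorphism that fixes two
  points \<open>x \<noteq> y\<close> also fixes every \<open>g(x,y)\<close>, hence everything: \<open>H\<close> is sharply doubly transitive.

  It remains to see that a finite sharply doubly transitive group has prime power degree \<open>n\<close>.
  Counting shows that exactly \<open>n - 1\<close> elements of \<open>H\<close> are free of fixed points. Let \<open>t\<close> be one
  of them. A nontrivial element that commutes with \<open>t\<close> has no fixed point: together with a
  fixed point \<open>x\<close> it would fix \<open>t x \<noteq> x\<close>. Therefore the \<open>n - 1\<close> elements of a point stabiliser
  conjugate \<open>t\<close> to \<open>n - 1\<close> different elements, that is, to all fixed-point-free ones, and it
  follows that \<open>H\<close> is the product of the centraliser of \<open>t\<close> and a point stabiliser. So the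
  centraliser of \<open>t\<close> is regular on the points; it has order \<open>n\<close> and consists of the identity
  and all fixed-point-free elements. These are conjugate in \<open>H\<close>, so they all have the same order,
  and by Cauchy's theorem a finite group with this property has prime power order.
\<close>

section \<open>Finite groups whose nontrivial elements have equal order\<close>

text \<open>Cauchy's theorem, read off from the existence of a subgroup of order \<open>p\<close>.\<close>

lemma exists_element_of_prime_order:
  fixes p :: nat
  assumes "group G" "finite (carrier G)" "prime p" "p dvd order G"
  shows "\<exists>x\<in>carrier G. group.ord G x = p"
proof -
  interpret group G by fact
  from assms(4) obtain m where "order G = p ^ 1 * m" by auto
  from sylow_thm[OF assms(3,1) this assms(2)] obtain K
    where K: "subgroup K G" and cardK: "card K = p" by auto
  have "1 < card K" using cardK assms(3) prime_gt_1_nat by auto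
  then have "\<not> K \<subseteq> {\<one>\<^bsub>G\<^esub>}"
    by (metis card_mono card.empty card_insert_disjoint empty_iff finite.emptyI finite.insertI
        not_less One_nat_def)
  then obtain x where x: "x \<in> K" "x \<noteq> \<one>\<^bsub>G\<^esub>" by auto
  have xG: "x \<in> carrier G" using K x(1) by (rule subgroup.mem_carrier)
  interpret K: group "G\<lparr>carrier := K\<rparr>" using K by (rule subgroup_imp_group)
  have "x [^]\<^bsub>G\<lparr>carrier := K\<rparr>\<^esub> order (G\<lparr>carrier := K\<rparr>) = \<one>\<^bsub>G\<lparr>carrier := K\<rparr>\<^esub>"
    using x(1) by (intro K.pow_order_eq_1) simp
  then have "x [^]\<^bsub>G\<^esub> p = \<one>\<^bsub>G\<^esub>"
    by (simp add: order_def cardK nat_pow_def)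
  then have "ord x dvd p" using pow_eq_id[OF xG] by simp
  moreover have "ord x \<noteq> 1" using ord_eq_1[OF xG] x(2) by simp
  ultimately have "ord x = p" using assms(3) by (auto simp: prime_nat_iff)
  with xG show ?thesis by auto
qed

lemma prime_power_if_only_one_prime_divisor:
  fixes n p :: nat
  assumes "0 < n" "prime p" "\<And>q. prime q \<Longrightarrow> q dvd n \<Longrightarrow> q = p"
  shows "\<exists>k. n = p ^ k"
proof -
  have "\<not> is_unit p" using assms(2) by (metis not_prime_unit)
  with assms(1) obtain y where y: "n = p ^ multiplicity p n * y" "\<not> p dvd y"
    using multiplicity_decompose'[of n p] by auto
  have "y = 1"
  proof (rule ccontr)
    assume "y \<noteq> 1"
    then obtain q where "prime q" "q dvd y" using prime_factor_nat by blast
    then show False using assms(3)[of q] y by (metis dvd_mult)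
  qed
  with y(1) show ?thesis by auto
qed

text \<open>Two prime divisors of the group order are orders of elements by Cauchy's theorem, so they
  coincide.\<close>

lemma prime_power_order_if_equal_orders:
  assumes "group G" "finite (carrier G)"
    and eq: "\<And>x y. \<lbrakk>x \<in> carrier G; y \<in> carrier G; x \<noteq> \<one>\<^bsub>G\<^esub>; y \<noteq> \<one>\<^bsub>G\<^esub>\<rbrakk>
      \<Longrightarrow> group.ord G x = group.ord G y"
  shows "\<exists>p k :: nat. prime p \<and> order G = p ^ k"
proof (cases "order G = 1")
  case True
  then show ?thesis by (intro exI[of _ 2] exI[of _ 0]) simp
next
  case False
  interpret group G by fact
  obtain p where p: "prime p" "p dvd order G" using False prime_factor_nat by blast
  have "q = p" if q: "prime q" "q dvd order G" for q
  proof -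
    obtain x where x: "x \<in> carrier G" "ord x = p"
      using exists_element_of_prime_order[OF assms(1,2) p] by auto
    obtain y where y: "y \<in> carrier G" "ord y = q"
      using exists_element_of_prime_order[OF assms(1,2) q] by auto
    have "x \<noteq> \<one>\<^bsub>G\<^esub>" "y \<noteq> \<one>\<^bsub>G\<^esub>" using x y p(1) q(1) ord_eq_1 by (metis not_prime_1)+
    then show ?thesis using eq x y by metis
  qed
  moreover have "0 < order G" using assms(2) order_gt_0_iff_finite by auto
  ultimately show ?thesis using prime_power_if_only_one_prime_divisor p(1) by metis
qed

section \<open>Sharply doubly transitive permutation groups\<close>

text \<open>A name for the inverse of a permutation that cannot be confused with the inverse of a
  group element.\<close>

abbreviation inv_perm :: "('a \<Rightarrow> 'a) \<Rightarrow> 'a \<Rightarrow> 'a"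
  where "inv_perm f \<equiv> inv_into UNIV f"

locale permutation_group =
  fixes S :: "'a set" and H :: "('a \<Rightarrow> 'a) set"
  assumes permutes: "f \<in> H \<Longrightarrow> f permutes S"
    and id_mem: "id \<in> H"
    and comp_mem: "f \<in> H \<Longrightarrow> g \<in> H \<Longrightarrow> f \<circ> g \<in> H"
    and inv_mem: "f \<in> H \<Longrightarrow> inv_perm f \<in> H"
begin

lemma mem_S_iff [simp]: "f \<in> H \<Longrightarrow> f x \<in> S \<longleftrightarrow> x \<in> S"
  using permutes permutes_in_image by metis

lemma inv_left [simp]: "f \<in> H \<Longrightarrow> inv_perm f (f x) = x"
  and inv_right [simp]: "f \<in> H \<Longrightarrow> f (inv_perm f x) = x"
  using permutes permutes_inverses by metis+

lemma inv_left_comp: "f \<in> H \<Longrightarrow> inv_perm f \<circ> f = id"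
  and inv_right_comp: "f \<in> H \<Longrightarrow> f \<circ> inv_perm f = id"
  by (simp_all add: fun_eq_iff)

lemma eq_iff [simp]: "f \<in> H \<Longrightarrow> f x = f y \<longleftrightarrow> x = y"
  by (metis inv_left)

text \<open>To move \<open>a\<close> to \<open>c\<close> use the stabiliser of a third point, which is why \<open>S\<close> must have three
  of them.\<close>

lemma doubly_transitive_if_stabilisers_transitive:
  assumes stab: "\<And>x y z. \<lbrakk>x \<in> S; y \<in> S; z \<in> S; y \<noteq> x; z \<noteq> x\<rbrakk> \<Longrightarrow> \<exists>f\<in>H. f x = x \<and> f y = z"
    and "2 < card S"
    and abcd: "a \<in> S" "b \<in> S" "a \<noteq> b" "c \<in> S" "d \<in> S" "c \<noteq> d"
  shows "\<exists>f\<in>H. f a = c \<and> f b = d"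
proof -
  have "\<not> S \<subseteq> {a, c}"
  proof
    assume "S \<subseteq> {a, c}"
    then have "card S \<le> card {a, c}" by (rule card_mono[rotated]) simp
    also have "\<dots> \<le> 2" by (simp add: card_insert_if)
    finally show False using assms(2) by simp
  qed
  then obtain e where e: "e \<in> S" "e \<noteq> a" "e \<noteq> c" by auto
  obtain f where f: "f \<in> H" "f a = c" using stab[OF e(1) abcd(1,4)] e by auto
  have "f b \<noteq> c" using f abcd(3) by (metis eq_iff)
  then obtain g where g: "g \<in> H" "g c = c" "g (f b) = d"
    using stab[of c "f b" d] abcd f(1) by auto
  show ?thesis using comp_mem[OF g(1) f(1)] f g by (intro bexI[of _ "g \<circ> f"]) auto
qed

definition fixed_point_free :: "('a \<Rightarrow> 'a) set"
  where "fixed_point_free = {f \<in> H. \<forall>x\<in>S. f x \<noteq> x}"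

definition stabiliser :: "'a \<Rightarrow> ('a \<Rightarrow> 'a) set"
  where "stabiliser x = {f \<in> H. f x = x}"

definition centraliser :: "('a \<Rightarrow> 'a) \<Rightarrow> ('a \<Rightarrow> 'a) set"
  where "centraliser t = {f \<in> H. f \<circ> t = t \<circ> f}"

lemma id_mem_centraliser: "id \<in> centraliser t"
  by (simp add: centraliser_def id_mem)

lemma comp_mem_centraliser:
  assumes "f \<in> centraliser t" "g \<in> centraliser t"
  shows "f \<circ> g \<in> centraliser t"
  using assms by (auto simp: centraliser_def comp_mem fun_eq_iff)

lemma inv_mem_centraliser:
  assumes "f \<in> centraliser t"
  shows "inv_perm f \<in> centraliser t"
proof -
  have f: "f \<in> H" "\<And>x. f (t x) = t (f x)"
    using assms by (auto simp: centraliser_def fun_eq_iff)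
  have "inv_perm f (t x) = t (inv_perm f x)" for x
    using f by (metis inv_left inv_right)
  then show ?thesis using f(1) by (auto simp: centraliser_def inv_mem fun_eq_iff)
qed

definition centraliser_group :: "('a \<Rightarrow> 'a) \<Rightarrow> ('a \<Rightarrow> 'a) monoid"
  where "centraliser_group t = \<lparr>carrier = centraliser t, mult = (\<circ>), one = id\<rparr>"

lemma centraliser_group_simps [simp]:
  "carrier (centraliser_group t) = centraliser t"
  "mult (centraliser_group t) = (\<circ>)"
  "one (centraliser_group t) = id"
  by (simp_all add: centraliser_group_def)

lemma group_centraliser: "group (centraliser_group t)"
proof (rule groupI)
  fix f assume f: "f \<in> carrier (centraliser_group t)"
  then have "f \<in> H" by (simp add: centraliser_def)
  with f have "inv_perm f \<in> centraliser t" "inv_perm f \<circ> f = id"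
    by (simp_all add: inv_mem_centraliser inv_left_comp)
  then show "\<exists>g\<in>carrier (centraliser_group t). g \<otimes>\<^bsub>centraliser_group t\<^esub> f
      = \<one>\<^bsub>centraliser_group t\<^esub>" by auto
qed (auto simp: comp_mem_centraliser id_mem_centraliser comp_assoc)

lemma conjugate_mem_fixed_point_free:
  assumes "f \<in> H" "t \<in> fixed_point_free"
  shows "f \<circ> t \<circ> inv_perm f \<in> fixed_point_free"
proof -
  have t: "t \<in> H" "\<And>x. x \<in> S \<Longrightarrow> t x \<noteq> x" using assms(2) by (auto simp: fixed_point_free_def)
  have "f (t (inv_perm f x)) \<noteq> x" if "x \<in> S" for x
    using t(2)[of "inv_perm f x"] that assms(1) inv_mem[OF assms(1)] by (metis inv_left mem_S_iff)
  then show ?thesis using assms(1) t(1) by (auto simp: fixed_point_free_def comp_mem inv_mem)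
qed

end

locale sharply_doubly_transitive = permutation_group +
  assumes finite_S: "finite S"
    and two_le_card: "2 \<le> card S"
    and exists_unique: "\<lbrakk>a \<in> S; b \<in> S; a \<noteq> b; c \<in> S; d \<in> S; c \<noteq> d\<rbrakk>
      \<Longrightarrow> \<exists>!f. f \<in> H \<and> f a = c \<and> f b = d"
begin

lemma eqI:
  assumes "f \<in> H" "g \<in> H" "a \<in> S" "b \<in> S" "a \<noteq> b" "f a = g a" "f b = g b"
  shows "f = g"
  using exists_unique[OF assms(3-5), of "g a" "g b"] assms by auto

lemma S_nonempty: "S \<noteq> {}"
  using two_le_card by auto

lemma exists_other:
  assumes "x \<in> S"
  shows "\<exists>y\<in>S. y \<noteq> x"
proof (rule ccontr)
  assume "\<not> ?thesis"
  then have "S \<subseteq> {x}" by auto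
  then have "card S \<le> card {x}" by (rule card_mono[rotated]) simp
  then show False using two_le_card by simp
qed

lemma finite_H: "finite H"
  by (rule finite_subset[OF _ finite_permutations[OF finite_S]]) (auto intro: permutes)

lemma card_H: "card H = card S * (card S - 1)"
proof -
  obtain a where a: "a \<in> S" using S_nonempty by auto
  obtain b where b: "b \<in> S" "b \<noteq> a" using exists_other a by auto
  have "bij_betw (\<lambda>f. (f a, f b)) H (SIGMA c:S. S - {c})"
  proof (intro bij_betw_imageI equalityI subsetI)
    show "inj_on (\<lambda>f. (f a, f b)) H" using eqI a b by (auto simp: inj_on_def)
  next
    fix cd assume "cd \<in> (SIGMA c:S. S - {c})"
    then obtain c d where "cd = (c, d)" "c \<in> S" "d \<in> S" "c \<noteq> d" by auto
    then show "cd \<in> (\<lambda>f. (f a, f b)) ` H"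
      using exists_unique[OF a b(1) b(2)[symmetric], of c d] by auto
  qed (use a b in auto)
  then have "card H = card (SIGMA c:S. S - {c})" by (rule bij_betw_same_card)
  also have "\<dots> = card S * (card S - 1)" using finite_S by (simp add: card_SigmaI)
  finally show ?thesis .
qed

lemma card_stabiliser:
  assumes "x \<in> S"
  shows "card (stabiliser x) = card S - 1"
proof -
  obtain b where b: "b \<in> S" "b \<noteq> x" using exists_other assms by auto
  have "bij_betw (\<lambda>f. f b) (stabiliser x) (S - {x})"
  proof (intro bij_betw_imageI equalityI subsetI)
    show "inj_on (\<lambda>f. f b) (stabiliser x)"
      using eqI assms b by (auto simp: inj_on_def stabiliser_def)
  next
    fix d assume "d \<in> S - {x}"
    then show "d \<in> (\<lambda>f. f b) ` stabiliser x"
      using exists_unique[OF assms b(1) b(2)[symmetric], of x d] assms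
      by (auto simp: stabiliser_def)
  next
    fix d assume "d \<in> (\<lambda>f. f b) ` stabiliser x"
    then obtain f where f: "f \<in> H" "f x = x" "d = f b" by (auto simp: stabiliser_def)
    then have "d \<noteq> x" using b(2) by (metis eq_iff)
    then show "d \<in> S - {x}" using f b by auto
  qed
  then have "card (stabiliser x) = card (S - {x})" by (rule bij_betw_same_card)
  then show ?thesis using assms finite_S by simp
qed

text \<open>Let \<open>n\<close> be the degree. The nontrivial elements with a fixed point form \<open>n\<close> disjoint sets of size \<open>n - 2\<close>, one for
  each point, because no nontrivial element has two fixed points. Of the \<open>n (n - 1) - 1\<close>
  nontrivial elements this leaves \<open>n - 1\<close>.\<close>

lemma card_fixed_point_free: "card fixed_point_free = card S - 1"
proof -
  let ?U = "\<Union>x\<in>S. stabiliser x - {id}"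
  have fin: "finite (stabiliser x)" for x
    using finite_H by (simp add: stabiliser_def)
  have "card ?U = (\<Sum>x\<in>S. card (stabiliser x - {id}))"
    by (rule card_UN_disjoint) (use finite_S fin eqI[OF _ id_mem] in \<open>auto simp: stabiliser_def\<close>)
  also have "\<dots> = (\<Sum>x\<in>S. card S - 2)"
    using card_stabiliser fin id_mem by (intro sum.cong) (auto simp: stabiliser_def)
  finally have U: "card ?U = card S * (card S - 2)" by simp
  have "H - {id} = fixed_point_free \<union> ?U"
    using exists_other two_le_card
    by (auto simp: fixed_point_free_def stabiliser_def)
  moreover have "fixed_point_free \<inter> ?U = {}"
    by (auto simp: fixed_point_free_def stabiliser_def)
  moreover have "finite fixed_point_free" "finite ?U"
    using finite_H finite_S fin by (auto simp: fixed_point_free_def)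
  ultimately have "card (H - {id}) = card fixed_point_free + card ?U"
    by (simp add: card_Un_disjoint)
  then have eq: "card S * (card S - 1) - 1 = card fixed_point_free + card S * (card S - 2)"
    using U card_H id_mem finite_H by simp
  obtain m where "card S = m + 2" using two_le_card by (metis add.commute le_Suc_ex)
  with eq show ?thesis by simp
qed

lemma centraliser_fixes_point_imp_id:
  assumes "t \<in> fixed_point_free" "f \<in> centraliser t" "x \<in> S" "f x = x"
  shows "f = id"
proof (rule eqI[of _ _ x "t x"])
  have "f (t x) = t (f x)" using assms(2) by (auto simp: centraliser_def fun_eq_iff)
  then show "f (t x) = id (t x)" using assms(4) by simp
qed (use assms id_mem in \<open>auto simp: fixed_point_free_def centraliser_def\<close>)

text \<open>The map \<open>g \<mapsto> g t g\<^sup>-\<^sup>1\<close> is injective on the stabiliser of \<open>x\<close>, since no nontrivial element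
  there commutes with \<open>t\<close>, and the stabiliser has as many elements as there are fixed-point-free ones.\<close>

lemma stabiliser_conjugates_onto_fixed_point_free:
  assumes t: "t \<in> fixed_point_free" and x: "x \<in> S"
  shows "(\<lambda>g. g \<circ> t \<circ> inv_perm g) ` stabiliser x = fixed_point_free"
proof (rule card_subset_eq)
  show "finite fixed_point_free" using finite_H by (simp add: fixed_point_free_def)
  show "(\<lambda>g. g \<circ> t \<circ> inv_perm g) ` stabiliser x \<subseteq> fixed_point_free"
    using conjugate_mem_fixed_point_free t by (auto simp: stabiliser_def)
  have "inj_on (\<lambda>g. g \<circ> t \<circ> inv_perm g) (stabiliser x)"
  proof (rule inj_onI)
    fix g h assume gh: "g \<in> stabiliser x" "h \<in> stabiliser x"
      and eq: "g \<circ> t \<circ> inv_perm g = h \<circ> t \<circ> inv_perm h"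
    have H: "g \<in> H" "h \<in> H" "g x = x" "h x = x" using gh by (auto simp: stabiliser_def)
    have "inv_perm h (g (t y)) = t (inv_perm h (g y))" for y
      using fun_cong[OF eq, of "g y"] H by simp
    then have "inv_perm h \<circ> g \<in> centraliser t"
      using H by (auto simp: centraliser_def comp_mem inv_mem fun_eq_iff)
    moreover have "(inv_perm h \<circ> g) x = x" using H inv_left[of h x] by simp
    ultimately have "inv_perm h \<circ> g = id" using centraliser_fixes_point_imp_id t x by blast
    then show "g = h" using H by (metis inv_right_comp comp_assoc comp_id id_comp)
  qed
  then show "card ((\<lambda>g. g \<circ> t \<circ> inv_perm g) ` stabiliser x) = card fixed_point_free"
    using card_image card_stabiliser[OF x] card_fixed_point_free by metis
qed

text \<open>If \<open>f\<close> moves \<open>y\<close> to \<open>x\<close> and \<open>g\<close> in the stabiliser of \<open>x\<close> conjugates \<open>t\<close> to the same element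
  as \<open>f\<close> does, then \<open>g\<^sup>-\<^sup>1 f\<close> commutes with \<open>t\<close> and still moves \<open>y\<close> to \<open>x\<close>; its
  inverse is the required element.\<close>

lemma centraliser_transitive:
  assumes t: "t \<in> fixed_point_free" and xy: "x \<in> S" "y \<in> S"
  shows "\<exists>c\<in>centraliser t. c x = y"
proof -
  obtain x' y' where "x' \<in> S" "x' \<noteq> x" "y' \<in> S" "y' \<noteq> y" using exists_other xy by metis
  then obtain f where f: "f \<in> H" "f y = x" using exists_unique[of y y' x x'] xy by metis
  have "f \<circ> t \<circ> inv_perm f \<in> (\<lambda>g. g \<circ> t \<circ> inv_perm g) ` stabiliser x"
    using conjugate_mem_fixed_point_free[OF f(1) t]
    by (simp add: stabiliser_conjugates_onto_fixed_point_free[OF t xy(1)])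
  then obtain g where g: "g \<in> H" "g x = x" and eq: "f \<circ> t \<circ> inv_perm f = g \<circ> t \<circ> inv_perm g"
    by (auto simp: stabiliser_def)
  have "inv_perm g (f (t z)) = t (inv_perm g (f z))" for z
    using fun_cong[OF eq, of "f z"] f g by simp
  then have c: "inv_perm g \<circ> f \<in> centraliser t"
    using f g by (auto simp: centraliser_def comp_mem inv_mem fun_eq_iff)
  have "(inv_perm g \<circ> f) y = x" using f g inv_left[of g x] by simp
  moreover have "inv_perm g \<circ> f \<in> H" using c by (simp add: centraliser_def)
  ultimately have "inv_perm (inv_perm g \<circ> f) x = y" using inv_left by metis
  then show ?thesis using inv_mem_centraliser[OF c] by auto
qed

text \<open>Evaluation at a point is a bijection, as the centraliser is transitive and its nontrivial
  elements have no fixed points.\<close>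

lemma card_centraliser:
  assumes t: "t \<in> fixed_point_free"
  shows "card (centraliser t) = card S"
proof -
  obtain x where x: "x \<in> S" using S_nonempty by auto
  have H: "c \<in> H" if "c \<in> centraliser t" for c using that by (simp add: centraliser_def)
  have "bij_betw (\<lambda>c. c x) (centraliser t) S"
  proof (intro bij_betw_imageI inj_onI)
    fix c d assume cd: "c \<in> centraliser t" "d \<in> centraliser t" "c x = d x"
    have "(inv_perm d \<circ> c) x = x" using cd H by simp
    then have "inv_perm d \<circ> c = id"
      using centraliser_fixes_point_imp_id[OF t _ x]
        comp_mem_centraliser[OF inv_mem_centraliser[OF cd(2)] cd(1)] by blast
    then show "c = d" using H cd by (metis inv_right_comp comp_assoc comp_id id_comp)
  next
    show "(\<lambda>c. c x) ` centraliser t = S"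
      using H x centraliser_transitive[OF t x] by auto
  qed
  then show ?thesis by (rule bij_betw_same_card)
qed

lemma centraliser_eq:
  assumes t: "t \<in> fixed_point_free"
  shows "centraliser t = insert id fixed_point_free"
proof (rule card_subset_eq)
  have fin: "finite fixed_point_free" using finite_H by (simp add: fixed_point_free_def)
  then show "finite (insert id fixed_point_free)" by simp
  show "centraliser t \<subseteq> insert id fixed_point_free"
    using centraliser_fixes_point_imp_id[OF t]
    by (auto simp: fixed_point_free_def centraliser_def)
  obtain x where x: "x \<in> S" using S_nonempty by auto
  then have "id \<notin> fixed_point_free" by (auto simp: fixed_point_free_def)
  then have "card (insert id fixed_point_free) = card S"
    using fin card_fixed_point_free two_le_card by simp
  then show "card (centraliser t) = card (insert id fixed_point_free)"
    using card_centraliser[OF t] by simp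
qed

text \<open>Conjugation by \<open>f\<close> is injective and respects composition, and it maps the centraliser to
  itself because the centraliser is the whole set of fixed-point-free elements with the identity.\<close>

lemma ord_conjugate:
  assumes t: "t \<in> fixed_point_free" and f: "f \<in> H" and s: "s \<in> centraliser t"
  shows "group.ord (centraliser_group t) (f \<circ> s \<circ> inv_perm f) = group.ord (centraliser_group t) s"
proof -
  interpret C: group "centraliser_group t" by (rule group_centraliser)
  have mem: "f \<circ> u \<circ> inv_perm f \<in> centraliser t" if "u \<in> centraliser t" for u
    using that conjugate_mem_fixed_point_free[OF f] inv_right_comp[OF f]
    by (auto simp: centraliser_eq[OF t])
  have "(\<lambda>u. f \<circ> u \<circ> inv_perm f) \<in> hom (centraliser_group t) (centraliser_group t)"
    using mem f by (intro homI) (auto simp: fun_eq_iff)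
  then have pow: "f \<circ> (s [^]\<^bsub>centraliser_group t\<^esub> k) \<circ> inv_perm f
      = (f \<circ> s \<circ> inv_perm f) [^]\<^bsub>centraliser_group t\<^esub> k" for k :: nat
    using hom_nat_pow[OF _ _ group_centraliser group_centraliser] s by fastforce
  have inj: "f \<circ> u \<circ> inv_perm f = id \<longleftrightarrow> u = id" for u
    using f by (auto simp: fun_eq_iff) (metis inv_left)
  have "(f \<circ> s \<circ> inv_perm f) [^]\<^bsub>centraliser_group t\<^esub> k = id \<longleftrightarrow> C.ord s dvd k" for k :: nat
    using C.pow_eq_id[of s k] s by (simp add: pow[symmetric] inj)
  then show ?thesis using C.ord_unique[of "f \<circ> s \<circ> inv_perm f" "C.ord s"] mem[OF s] by auto
qed

theorem prime_power_degree: "\<exists>p k :: nat. prime p \<and> card S = p ^ k"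
proof -
  have "fixed_point_free \<noteq> {}" using card_fixed_point_free two_le_card by auto
  then obtain t where t: "t \<in> fixed_point_free" by auto
  obtain x where x: "x \<in> S" using S_nonempty by auto
  have "\<exists>p k :: nat. prime p \<and> order (centraliser_group t) = p ^ k"
  proof (rule prime_power_order_if_equal_orders)
    show "finite (carrier (centraliser_group t))"
      using finite_H by (simp add: centraliser_def)
    fix r s assume "r \<in> carrier (centraliser_group t)" "s \<in> carrier (centraliser_group t)"
      "r \<noteq> \<one>\<^bsub>centraliser_group t\<^esub>" "s \<noteq> \<one>\<^bsub>centraliser_group t\<^esub>"
    then have rs: "r \<in> fixed_point_free" "s \<in> fixed_point_free" "r \<in> centraliser t"
      by (auto simp: centraliser_eq[OF t])
    then obtain f where "f \<in> H" "s = f \<circ> r \<circ> inv_perm f"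
      using stabiliser_conjugates_onto_fixed_point_free[OF rs(1) x]
      by (auto simp: stabiliser_def)
    then show "group.ord (centraliser_group t) r = group.ord (centraliser_group t) s"
      using ord_conjugate[OF t _ rs(3)] by simp
  qed (rule group_centraliser)
  then show ?thesis using card_centraliser[OF t] by (simp add: order_def)
qed

end

section \<open>Automorphisms of a binary action\<close>

context binary_G_space
begin

definition automorphisms :: "('x \<Rightarrow> 'x) set"
  where "automorphisms = {f. f permutes topspace X \<and>
    (\<forall>g\<in>carrier G. \<forall>x\<in>topspace X. \<forall>y\<in>topspace X. f (act g x y) = act g (f x) (f y))}"

text \<open>Permutations in \<^const>\<open>permutes\<close> are the identity outside the set that they permute.\<close>

definition translation :: "'g \<Rightarrow> 'x \<Rightarrow> 'x \<Rightarrow> 'x"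
  where "translation g x = (\<lambda>y. if y \<in> topspace X then act g x y else y)"

lemma act_closed:
  assumes "g \<in> carrier G" "x \<in> topspace X" "y \<in> topspace X"
  shows "act g x y \<in> topspace X"
proof -
  have "(g, x, y) \<in> topspace (prod_topology T (prod_topology X X))"
    using assms by (simp add: topspace_group)
  then have "(\<lambda>(g, x, y). act g x y) (g, x, y) \<in> topspace X"
    using continuous_map_image_subset_topspace[OF continuous_map_act] by blast
  then show ?thesis by simp
qed

lemma permutation_group_automorphisms: "permutation_group (topspace X) automorphisms"
proof
  fix f assume f: "f \<in> automorphisms"
  then show perm: "f permutes topspace X" by (simp add: automorphisms_def)
  have "inv_perm f (act g x y) = act g (inv_perm f x) (inv_perm f y)"
    if "g \<in> carrier G" "x \<in> topspace X" "y \<in> topspace X" for g x y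
  proof -
    have "inv_perm f x \<in> topspace X" "inv_perm f y \<in> topspace X"
      using that permutes_in_image[OF permutes_inv[OF perm]] by auto
    then have "f (act g (inv_perm f x) (inv_perm f y)) = act g x y"
      using f that permutes_inverses[OF perm] by (simp add: automorphisms_def)
    then show ?thesis using permutes_inverses[OF perm] by metis
  qed
  then show "inv_perm f \<in> automorphisms"
    using permutes_inv[OF perm] by (simp add: automorphisms_def)
next
  fix f h assume "f \<in> automorphisms" "h \<in> automorphisms"
  then show "f \<circ> h \<in> automorphisms"
    by (auto simp: automorphisms_def permutes_compose permutes_in_image)
qed (simp add: automorphisms_def permutes_id)

lemma translation_mem_automorphisms:
  assumes "distributive" "g \<in> carrier G" "x \<in> topspace X"
  shows "translation g x \<in> automorphisms"
proof -
  have "bij_betw (act g x) (topspace X) (topspace X)"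
    by (rule bij_betw_byWitness[where f' = "act (inv\<^bsub>G\<^esub> g) x"])
      (use assms act_closed act_one in \<open>auto simp flip: act_mult\<close>)
  then have "bij_betw (translation g x) (topspace X) (topspace X)"
    by (simp add: translation_def cong: bij_betw_cong)
  then have "translation g x permutes topspace X"
    by (rule bij_imp_permutes) (simp add: translation_def)
  moreover have "translation g x (act h y z) = act h (translation g x y) (translation g x z)"
    if "h \<in> carrier G" "y \<in> topspace X" "z \<in> topspace X" for h y z
  proof -
    have "act g x (act h y z) = act h (act g x y) (act g x z)"
      using assms that unfolding distributive_def by blast
    then show ?thesis using that by (simp add: translation_def act_closed)
  qed
  ultimately show ?thesis by (simp add: automorphisms_def)
qed

lemma semitransitiveD:
  assumes "semitransitive" "x \<in> topspace X"
  shows "g \<in> carrier G \<Longrightarrow> act g x x = x"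
    and "\<lbrakk>y \<in> topspace X; z \<in> topspace X; y \<noteq> x; z \<noteq> x\<rbrakk> \<Longrightarrow> \<exists>g\<in>carrier G. z = act g x y"
proof -
  have orbit: "orbit x x = {x}" "y \<in> topspace X \<Longrightarrow> y \<noteq> x \<Longrightarrow> orbit x y = topspace X - {x}" for y
    using assms by (auto simp: semitransitive_def)
  show "act g x x = x" if "g \<in> carrier G" using orbit(1) that by (auto simp: orbit_def)
  show "\<exists>g\<in>carrier G. z = act g x y"
    if "y \<in> topspace X" "z \<in> topspace X" "y \<noteq> x" "z \<noteq> x"
  proof -
    have "z \<in> orbit x y" using orbit(2) that by auto
    then show ?thesis by (auto simp: orbit_def)
  qed
qed

text \<open>The set \<open>X\<close> without a point is an orbit of a finite group.\<close>

lemma finite_topspace: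
  assumes "semitransitive" "finite (carrier G)"
  shows "finite (topspace X)"
proof (cases "\<exists>x\<in>topspace X. \<exists>y\<in>topspace X. x \<noteq> y")
  case True
  then obtain x y where "x \<in> topspace X" "y \<in> topspace X" "x \<noteq> y" by auto
  then have "topspace X - {x} = orbit x y" using assms(1) by (simp add: semitransitive_def)
  also have "\<dots> = (\<lambda>g. act g x y) ` carrier G" by (auto simp: orbit_def)
  finally have "finite (topspace X - {x})" using assms(2) by simp
  then show ?thesis by simp
next
  case False
  then have "topspace X \<subseteq> {x}" if "x \<in> topspace X" for x using that by auto
  then show ?thesis by (metis equals0I finite.emptyI finite.insertI finite_subset)
qed

text \<open>An automorphism is determined by its values at two points \<open>a \<noteq> b\<close>, since every point other
  than \<open>a\<close> has the form \<open>g(a,b)\<close>.\<close>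

lemma sharply_doubly_transitive_automorphisms:
  assumes semi: "semitransitive" and distr: "distributive"
    and fin: "finite (carrier G)" and card: "2 < card (topspace X)"
  shows "sharply_doubly_transitive (topspace X) automorphisms"
proof -
  interpret permutation_group "topspace X" automorphisms
    by (rule permutation_group_automorphisms)
  have stab: "\<exists>f\<in>automorphisms. f x = x \<and> f y = z"
    if xyz: "x \<in> topspace X" "y \<in> topspace X" "z \<in> topspace X" "y \<noteq> x" "z \<noteq> x" for x y z
  proof -
    obtain g where "g \<in> carrier G" "z = act g x y"
      using semitransitiveD(2)[OF semi xyz] by auto
    then show ?thesis
      using xyz semitransitiveD(1)[OF semi] translation_mem_automorphisms[OF distr]
      by (intro bexI[of _ "translation g x"]) (auto simp: translation_def)
  qed
  show ?thesis
  proof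
    fix a b c d
    assume abcd: "a \<in> topspace X" "b \<in> topspace X" "a \<noteq> b"
      "c \<in> topspace X" "d \<in> topspace X" "c \<noteq> d"
    show "\<exists>!f. f \<in> automorphisms \<and> f a = c \<and> f b = d"
    proof (rule ex_ex1I)
      show "\<exists>f. f \<in> automorphisms \<and> f a = c \<and> f b = d"
        using doubly_transitive_if_stabilisers_transitive[OF stab card abcd] by auto
    next
      fix f h
      assume f: "f \<in> automorphisms \<and> f a = c \<and> f b = d"
        and h: "h \<in> automorphisms \<and> h a = c \<and> h b = d"
      show "f = h"
      proof
        fix z
        consider "z \<notin> topspace X" | "z = a" | "z \<in> topspace X" "z \<noteq> a" by auto
        then show "f z = h z"
        proof cases
          case 1
          then show ?thesis using f h permutes permutes_not_in by metis
        next
          case 2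
          then show ?thesis using f h by simp
        next
          case 3
          then obtain g where "g \<in> carrier G" "z = act g a b"
            using semitransitiveD(2)[OF semi abcd(1,2)] abcd(3) by auto
          then show ?thesis using f h abcd by (simp add: automorphisms_def)
        qed
      qed
    qed
  qed (use card finite_topspace[OF semi fin] in auto)
qed

end

theorem corollary3p15:
  fixes G :: "('g, 'm) monoid_scheme"
    and T :: "'g topology"
    and X :: "'x topology"
    and act :: "'g \<Rightarrow> 'x \<Rightarrow> 'x \<Rightarrow> 'x"
  assumes "binary_G_space G T X act"
    and "finite (carrier G)"
    and "topspace X \<noteq> {}"
    and "binary_G_space.effective G X act"
    and "binary_G_space.semitransitive G X act"
    and "binary_G_space.distributive G X act"
  shows "\<exists>p n :: nat. prime p \<and> card (topspace X) = p ^ n"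
proof -
  interpret binary_G_space G T X act by fact
  have "0 < card (topspace X)"
    using finite_topspace[OF assms(5,2)] assms(3) by (simp add: card_gt_0_iff)
  then consider "card (topspace X) = 2 ^ 0" | "card (topspace X) = 2 ^ 1" | "2 < card (topspace X)"
    by fastforce
  then show ?thesis
  proof cases
    case 3
    then interpret sharply_doubly_transitive "topspace X" automorphisms
      by (rule sharply_doubly_transitive_automorphisms[OF assms(5,6,2)])
    show ?thesis by (rule prime_power_degree)
  qed (use two_is_prime_nat in blast)+
qed

end
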